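(* Let $R$ be an idempotent semiring. Let $K$ be a unitgenerated $R$-algebra. The quasiintegral closure of $R$ in $K$ is the intersection of all valuation subsemirings of $K$ which contain (the image of) $R$.
   Context: Semirings are commutative with $0$ and $1$. A semiring is idempotent if $x+x=x$ for all $x$; it then carries the canonical partial order $x\leq y\iff x+y=y$. An $R$-algebra is a semiring $A$ with a homomorphism $R\to A$. An idempotent semiring $K$ is unitgenerated if every element is a finite sum of units (the empty sum being $0$); $K^\times$ is its group of units. A subset $N$ (subsemigroup, subsemiring, submodule) is saturated if $z\leq y$ and $y\in N$ imply $z\in N$. A valuation subsemiring of $K$ is a saturated subsemiring $V\subseteq K$ such that for every $x\in K^\times$, either $x\in V$ or $x^{-1}\in V$. An $R$-module $M$ is finite if there is $m\in M$ such that for every $y\in M$ there is $r\in R$ with $y\leq rm$. An $R$-module $M$ is faithful if $rM\neq 0$ for all nonzero $r\in R$. For an $R$-algebra $A$ and $x\in A$, $R\langle x\rangle$ denotes the smallest saturated subsemiring of $A$ containing $x$ and the image of $R$. The element $x$ is quasiintegral over $R$ if there is an $R\langle x\rangle$-submodule $M\subseteq A$ which is finite as an $R$-module and faithful as an $R\langle x\rangle$-module. The quasiintegral closure of $R$ in $A$ is the set of elements of $A$ which are quasiintegral over $R$. *)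

theory Defs
  imports Main "HOL.Hull"
begin

text \<open>
  Idempotent semirings. The class \<open>comm_semiring_1\<close> is not used as a base because it imposes
  \<open>0 \<noteq> 1\<close>; the trivial semiring is allowed here.
\<close>

class idem_comm_semiring = comm_semiring_0 + comm_monoid_mult +
  assumes add_idem: "x + x = x"

text \<open>The empty list of units accounts for the empty sum.\<close>

class unitgenerated_semiring = idem_comm_semiring +
  assumes unitgenerated: "\<exists>us. (\<forall>u\<in>set us. \<exists>v. u * v = 1) \<and> x = sum_list us"

definition canon_le :: "'a::idem_comm_semiring \<Rightarrow> 'a \<Rightarrow> bool"  (infix "\<preceq>" 50)
  where "x \<preceq> y \<longleftrightarrow> x + y = y"

definition saturated :: "'a::idem_comm_semiring set \<Rightarrow> bool"
  where "saturated N \<longleftrightarrow> (\<forall>y\<in>N. \<forall>z. z \<preceq> y \<longrightarrow> z \<in> N)"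

definition subsemiring :: "'a::idem_comm_semiring set \<Rightarrow> bool"
  where "subsemiring S \<longleftrightarrow> 0 \<in> S \<and> 1 \<in> S \<and> (\<forall>x\<in>S. \<forall>y\<in>S. x + y \<in> S \<and> x * y \<in> S)"

text \<open>
  Below, \<open>x * y = 1\<close> says that \<open>x\<close> is a unit with inverse \<open>y\<close>; the inverse is unique.
\<close>

definition valuation_subsemiring :: "'a::idem_comm_semiring set \<Rightarrow> bool"
  where "valuation_subsemiring V \<longleftrightarrow>
    subsemiring V \<and> saturated V \<and> (\<forall>x y. x * y = 1 \<longrightarrow> x \<in> V \<or> y \<in> V)"

definition semiring_hom :: "('r::idem_comm_semiring \<Rightarrow> 'a::idem_comm_semiring) \<Rightarrow> bool"
  where "semiring_hom \<phi> \<longleftrightarrow> \<phi> 0 = 0 \<and> \<phi> 1 = 1 \<and>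
    (\<forall>r s. \<phi> (r + s) = \<phi> r + \<phi> s) \<and> (\<forall>r s. \<phi> (r * s) = \<phi> r * \<phi> s)"

text \<open>
  All modules occurring here are additive submonoids \<open>M\<close> of a semiring \<open>A\<close>, on which a set \<open>S\<close> of
  scalars (a semiring, or a subsemiring of one) acts by a function \<open>act\<close>.
\<close>

definition submodule_of ::
    "'s set \<Rightarrow> ('s \<Rightarrow> 'a \<Rightarrow> 'a) \<Rightarrow> 'a::idem_comm_semiring set \<Rightarrow> bool"
  where "submodule_of S act M \<longleftrightarrow>
    0 \<in> M \<and> (\<forall>x\<in>M. \<forall>y\<in>M. x + y \<in> M) \<and> (\<forall>s\<in>S. \<forall>x\<in>M. act s x \<in> M)"

text \<open>Finiteness refers to the canonical order, not to a finite generating set.\<close>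

definition finite_module ::
    "'s set \<Rightarrow> ('s \<Rightarrow> 'a \<Rightarrow> 'a) \<Rightarrow> 'a::idem_comm_semiring set \<Rightarrow> bool"
  where "finite_module S act M \<longleftrightarrow> (\<exists>m\<in>M. \<forall>y\<in>M. \<exists>r\<in>S. y \<preceq> act r m)"

definition faithful_module ::
    "'s::zero set \<Rightarrow> ('s \<Rightarrow> 'a \<Rightarrow> 'a) \<Rightarrow> 'a::idem_comm_semiring set \<Rightarrow> bool"
  where "faithful_module S act M \<longleftrightarrow> (\<forall>r\<in>S. r \<noteq> 0 \<longrightarrow> act r ` M \<noteq> {0})"

text \<open>
  An \<open>R\<close>-algebra is given by its structure homomorphism \<open>\<phi>\<close>. The next definition is
  \<open>R\<langle>x\<rangle>\<close>; the lemma after it states that it is the smallest saturated subsemiring of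
  the required kind.
\<close>

definition sat_adjoin ::
    "('r::idem_comm_semiring \<Rightarrow> 'a::idem_comm_semiring) \<Rightarrow> 'a \<Rightarrow> 'a set"
  where "sat_adjoin \<phi> x = (\<lambda>S. subsemiring S \<and> saturated S) hull (insert x (range \<phi>))"

lemma sat_adjoin_smallest:
  fixes \<phi> :: "'r::idem_comm_semiring \<Rightarrow> 'a::idem_comm_semiring"
  shows "subsemiring (sat_adjoin \<phi> x)" "saturated (sat_adjoin \<phi> x)"
    and "x \<in> sat_adjoin \<phi> x" "range \<phi> \<subseteq> sat_adjoin \<phi> x"
    and "\<lbrakk>subsemiring S; saturated S; x \<in> S; range \<phi> \<subseteq> S\<rbrakk> \<Longrightarrow> sat_adjoin \<phi> x \<subseteq> S"
proof -
  let ?P = "\<lambda>S. subsemiring S \<and> saturated S"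
  have P: "?P (\<Inter>F)" if "\<And>S. S \<in> F \<Longrightarrow> ?P S" for F :: "'a set set"
    using that unfolding subsemiring_def saturated_def by (auto; metis)
  have "?P (sat_adjoin \<phi> x)"
    unfolding sat_adjoin_def by (rule hull_in) (rule P, blast)
  then show "subsemiring (sat_adjoin \<phi> x)" "saturated (sat_adjoin \<phi> x)"
    by simp_all
  have "insert x (range \<phi>) \<subseteq> sat_adjoin \<phi> x"
    unfolding sat_adjoin_def by (rule hull_subset)
  then show "x \<in> sat_adjoin \<phi> x" "range \<phi> \<subseteq> sat_adjoin \<phi> x"
    by simp_all
  show "sat_adjoin \<phi> x \<subseteq> S" if "subsemiring S" "saturated S" "x \<in> S" "range \<phi> \<subseteq> S"
    unfolding sat_adjoin_def by (rule hull_minimal) (use that in simp_all)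
qed

definition quasiintegral ::
    "('r::idem_comm_semiring \<Rightarrow> 'a::idem_comm_semiring) \<Rightarrow> 'a \<Rightarrow> bool"
  where "quasiintegral \<phi> x \<longleftrightarrow>
    (\<exists>M. submodule_of (sat_adjoin \<phi> x) (*) M \<and>
         finite_module UNIV (\<lambda>r m. \<phi> r * m) M \<and>
         faithful_module (sat_adjoin \<phi> x) (*) M)"

definition quasiintegral_closure ::
    "('r::idem_comm_semiring \<Rightarrow> 'a::idem_comm_semiring) \<Rightarrow> 'a set"
  where "quasiintegral_closure \<phi> = {x. quasiintegral \<phi> x}"

end

theory Submission
  imports Defs
begin

text \<open>
  Since \<open>K\<close> has no zero divisors, quasiintegrality of \<open>x\<close> over \<open>R\<close> amounts to
  \<open>x m \<le> r m\<close> for some \<open>r \<in> R\<close> and some nonzero \<open>m \<in> K\<close>.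

  If this holds and \<open>V \<supseteq> R\<close> is a valuation subsemiring, write \<open>m\<close> as a sum of units and divide by
  the largest one with respect to \<open>V\<close>; then \<open>1 \<le> m \<in> V\<close>, so \<open>x \<le> x m \<le> r m \<in> V\<close>.

  Conversely, if there are no such \<open>r\<close> and \<open>m\<close>, take a saturated subsemiring \<open>V \<supseteq> R\<close> maximal with
  the property that \<open>x m \<le> a m\<close> has no solution with \<open>a \<in> V\<close> and \<open>m \<noteq> 0\<close>. Were neither the unit \<open>w\<close>
  nor its inverse \<open>v\<close> in \<open>V\<close>, then adjoining either of them would give, for \<open>e = 1 + w\<close> and
  \<open>f = 1 + v\<close>, the bounds \<open>x m \<le> a e\<^sup>n m\<close> and \<open>x m \<le> a f\<^sup>n m\<close>.
  As \<open>e\<^sup>n f\<^sup>n = e\<^sup>n + f\<^sup>n\<close>, the element \<open>m (e\<^sup>n + f\<^sup>n)\<close> would be a solution over \<open>V\<close>.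
\<close>

section \<open>The canonical order and powers of elements above 1\<close>

interpretation canon: bounded_semilattice_sup_bot
  "(+)" canon_le "\<lambda>x y. x \<preceq> y \<and> \<not> y \<preceq> x" "0 :: 'a::idem_comm_semiring"
proof
  fix x y z :: 'a
  show "x \<preceq> z" if "x \<preceq> y" "y \<preceq> z"
    using that unfolding canon_le_def by (metis add.assoc)
  show "x = y" if "x \<preceq> y" "y \<preceq> x"
    using that unfolding canon_le_def by (metis add.commute)
  show "y + z \<preceq> x" if "y \<preceq> x" "z \<preceq> x"
    using that unfolding canon_le_def by (metis add.assoc)
  show "x \<preceq> x + y" "y \<preceq> x + y"
    unfolding canon_le_def by (metis add.assoc add.commute add_idem)+
qed (auto simp: canon_le_def add_idem)

lemma canon_mult_left_mono: "a \<preceq> b \<Longrightarrow> c * a \<preceq> c * b"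
  unfolding canon_le_def by (simp flip: distrib_left)

lemma canon_mult_mono: "a \<preceq> b \<Longrightarrow> c \<preceq> d \<Longrightarrow> a * c \<preceq> b * d"
  by (metis canon.order_trans canon_mult_left_mono mult.commute)

lemma canon_le_mult: "1 \<preceq> b \<Longrightarrow> a \<preceq> a * b"
  using canon_mult_left_mono[of 1 b a] by simp

lemma canon_one_le_power: "1 \<preceq> a \<Longrightarrow> 1 \<preceq> a ^ n"
  by (induction n) (auto intro: canon.order_trans canon_le_mult)

lemma canon_power_mono: "1 \<preceq> e \<Longrightarrow> k \<le> n \<Longrightarrow> e ^ k \<preceq> e ^ n"
  by (metis canon_le_mult canon_one_le_power le_add_diff_inverse power_add)

text \<open>Induction on \<open>n\<close>, rewriting \<open>e ^ Suc n * f\<close> as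
  \<open>e ^ n * (e + f)\<close>. The bound absorbs the cross terms in the next lemma.\<close>

lemma power_mult_canon_le:
  assumes "1 \<preceq> e" and "e * f = e + f"
  shows "e ^ n * f \<preceq> e ^ n + f"
proof (induction n)
  case 0
  then show ?case by simp
next
  case (Suc n)
  have "e ^ Suc n * f = e ^ Suc n + e ^ n * f"
    by (metis assms(2) distrib_left mult.assoc power_Suc2)
  moreover have "e ^ n \<preceq> e ^ Suc n"
    using canon_le_mult[OF assms(1)] by (simp only: power_Suc2)
  then have "e ^ n * f \<preceq> e ^ Suc n + f"
    using Suc canon.sup_mono[OF _ canon.order_refl] canon.order_trans by blast
  ultimately show ?case
    by (simp only:) (intro canon.le_supI canon.sup_ge1)
qed

text \<open>In the induction step, \<open>(e ^ n + f ^ n) * (e + f)\<close> is expanded; both cross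
  terms lie below \<open>e ^ Suc n + f ^ Suc n\<close>. The case \<open>n = 0\<close> is
  \<open>1 = 1 + 1\<close>.\<close>

lemma power_mult_power_eq_add:
  assumes e: "1 \<preceq> e" and f: "1 \<preceq> f" and ef: "e * f = e + f"
  shows "e ^ n * f ^ n = e ^ n + f ^ n"
proof (induction n)
  case 0
  then show ?case by (simp add: add_idem)
next
  case (Suc n)
  have e1: "e ^ n \<preceq> e ^ Suc n" "e \<preceq> e ^ Suc n"
    using canon_le_mult[OF e] canon_le_mult[OF canon_one_le_power[OF e]]
    by (simp_all only: power_Suc2) (simp add: mult.commute)
  have f1: "f ^ n \<preceq> f ^ Suc n" "f \<preceq> f ^ Suc n"
    using canon_le_mult[OF f] canon_le_mult[OF canon_one_le_power[OF f]]
    by (simp_all only: power_Suc2) (simp add: mult.commute)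
  have "e ^ Suc n * f ^ Suc n = (e ^ n + f ^ n) * (e + f)"
    using Suc ef by (metis power_Suc2 power_mult_distrib)
  also have "\<dots> = e ^ Suc n + f ^ Suc n + (e ^ n * f + f ^ n * e)"
    by (simp add: algebra_simps)
  also have "\<dots> = e ^ Suc n + f ^ Suc n"
  proof -
    have "e ^ n * f \<preceq> e ^ Suc n + f ^ Suc n"
      using power_mult_canon_le[OF e ef] e1(1) f1(2) by (meson canon.order_trans canon.sup_mono)
    moreover have "f ^ n * e \<preceq> f ^ Suc n + e ^ Suc n"
      using power_mult_canon_le[OF f, of e n] ef f1(1) e1(2)
      by (metis add.commute canon.order_trans canon.sup_mono mult.commute)
    ultimately show ?thesis
      by (metis add.commute canon.le_supI canon.sup_absorb1)
  qed
  finally show ?case .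
qed

section \<open>Units, zero divisors and valuation subsemirings\<close>

text \<open>A nonzero \<open>x\<close> has a unit summand \<open>u\<close>, so
  \<open>u * y \<preceq> x * y = 0\<close>. As \<open>0\<close> is the least element,
  \<open>u * y = 0\<close>, and the unit cancels.\<close>

lemma unitgenerated_no_zero_divisors:
  fixes x y :: "'k::unitgenerated_semiring"
  assumes "x * y = 0"
  shows "x = 0 \<or> y = 0"
proof -
  obtain us where us: "\<forall>u\<in>set us. \<exists>v. u * v = 1" "x = sum_list us"
    using unitgenerated by blast
  show ?thesis
  proof (cases us)
    case (Cons u us')
    then obtain v where v: "u * v = 1" using us by auto
    have "u * y \<preceq> x * y"
      using us(2) Cons by (simp add: canon_mult_mono)
    then have "u * y = 0"
      using assms canon.le_bot by metis
    then have "y = 0"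
      using v by (metis mult.commute mult.left_commute mult_1 mult_zero_right)
    then show ?thesis ..
  qed (use us in simp)
qed

lemma unit_cancel: "u * v = 1 \<Longrightarrow> u * (v * x) = (x :: 'a::comm_monoid_mult)"
  by (simp flip: mult.assoc)

text \<open>Here \<open>u\<close> is a summand that is largest with respect to \<open>V\<close> and
  \<open>v\<close> is its inverse, so \<open>v\<close> carries every summand into
  \<open>V\<close>.\<close>

lemma valuation_normalize_units:
  fixes V :: "'a::idem_comm_semiring set"
  assumes V: "valuation_subsemiring V"
    and "us \<noteq> []" "\<forall>u\<in>set us. \<exists>v. u * v = 1"
  shows "\<exists>u v. u * v = 1 \<and> u \<preceq> sum_list us \<and> v * sum_list us \<in> V"
  using assms(2,3)
proof (induction us rule: list_nonempty_induct)
  case (single u)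
  then obtain v where "u * v = 1" by auto
  then show ?case
    using V unfolding valuation_subsemiring_def subsemiring_def
    by (intro exI[of _ u] exI[of _ v]) (simp add: mult.commute)
next
  case (cons u us)
  then obtain v where v: "u * v = 1" by auto
  obtain u' v' where u': "u' * v' = 1" "u' \<preceq> sum_list us" "v' * sum_list us \<in> V"
    using cons by auto
  \<comment> \<open>\<open>V\<close> compares the new unit \<open>u\<close> with the previous
    maximum \<open>u'\<close>: in the first case \<open>u'\<close> stays largest, in the second
    \<open>u\<close> replaces it.\<close>
  have "(u * v') * (u' * v) = 1"
    using v u' by (metis mult.assoc mult.commute mult_1)
  then consider "v' * u \<in> V" | "v * u' \<in> V"
    using V unfolding valuation_subsemiring_def by (metis mult.commute)
  then show ?case
  proof cases
    case 1
    then have "v' * (u + sum_list us) \<in> V"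
      using V u' unfolding valuation_subsemiring_def subsemiring_def by (simp add: distrib_left)
    then show ?thesis using u' by (auto intro: canon.le_supI2)
  next
    case 2
    then have "(v * u') * (v' * sum_list us) \<in> V"
      using V u' unfolding valuation_subsemiring_def subsemiring_def by blast
    then have "v * sum_list us \<in> V"
      using u'(1) by (simp add: unit_cancel mult.assoc)
    then have "v * (u + sum_list us) \<in> V"
      using V v unfolding valuation_subsemiring_def subsemiring_def
      by (simp add: distrib_left mult.commute)
    then show ?thesis using v canon.sup_ge1 by (metis sum_list.Cons)
  qed
qed

lemma valuation_normalize:
  fixes m :: "'k::unitgenerated_semiring"
  assumes "valuation_subsemiring V" and "m \<noteq> 0"
  shows "\<exists>v. 1 \<preceq> v * m \<and> v * m \<in> V"
proof -
  obtain us where "\<forall>u\<in>set us. \<exists>v. u * v = 1" "m = sum_list us"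
    using unitgenerated by blast
  moreover from this have "us \<noteq> []" using assms(2) by auto
  ultimately obtain u v where uv: "u * v = 1" "u \<preceq> m" "v * m \<in> V"
    using valuation_normalize_units[OF assms(1), of us] by auto
  then have "1 \<preceq> v * m"
    by (metis canon_mult_left_mono mult.commute)
  with uv show ?thesis by blast
qed

section \<open>Quasiintegrality without modules\<close>

text \<open>The coefficients range over an arbitrary set, so that the notion applies to the image of
  \<open>R\<close> as well as to the subsemirings above it.\<close>

definition bounded_on :: "'a::idem_comm_semiring set \<Rightarrow> 'a \<Rightarrow> bool"
  where "bounded_on S x \<longleftrightarrow> (\<exists>m a. m \<noteq> 0 \<and> a \<in> S \<and> x * m \<preceq> a * m)"

text \<open>The element \<open>m\<close> that witnesses finiteness of \<open>M\<close> also bounds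
  \<open>x * m\<close>, which lies in \<open>M\<close>. Faithfulness makes \<open>m\<close> nonzero:
  on \<open>{0}\<close> even the scalar \<open>1\<close> acts as zero.\<close>

lemma quasiintegral_imp_bounded_on:
  fixes \<phi> :: "'r::idem_comm_semiring \<Rightarrow> 'a::idem_comm_semiring"
  assumes "quasiintegral \<phi> x" and "(1::'a) \<noteq> 0"
  shows "bounded_on (range \<phi>) x"
proof -
  obtain M m where sub: "submodule_of (sat_adjoin \<phi> x) (*) M"
    and m: "m \<in> M" "\<And>y. y \<in> M \<Longrightarrow> \<exists>r. y \<preceq> \<phi> r * m"
    and faith: "faithful_module (sat_adjoin \<phi> x) (*) M"
    using assms(1) unfolding quasiintegral_def finite_module_def by auto
  have "m \<noteq> 0"
  proof
    assume "m = 0"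
    then have "M = {0}"
      using m canon.le_bot by fastforce
    moreover have "1 \<in> sat_adjoin \<phi> x"
      using sat_adjoin_smallest(1)[of \<phi> x] by (simp add: subsemiring_def)
    ultimately show False
      using faith assms(2) unfolding faithful_module_def by auto
  qed
  moreover have "x * m \<in> M"
    using sub m(1) sat_adjoin_smallest(3)[of x \<phi>] unfolding submodule_of_def by blast
  ultimately show ?thesis
    using m(2) unfolding bounded_on_def by blast
qed

lemma bounded_on_imp_quasiintegral:
  fixes \<phi> :: "'r::idem_comm_semiring \<Rightarrow> 'k::unitgenerated_semiring"
  assumes hom: "semiring_hom \<phi>" and "bounded_on (range \<phi>) x"
  shows "quasiintegral \<phi> x"
proof -
  have hom': "\<phi> 0 = 0" "\<phi> 1 = 1" "\<phi> (r + s) = \<phi> r + \<phi> s" "\<phi> (r * s) = \<phi> r * \<phi> s" for r s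
    using hom by (auto simp: semiring_hom_def)
  obtain m r where m: "m \<noteq> 0" and r: "x * m \<preceq> \<phi> r * m"
    using assms(2) unfolding bounded_on_def by blast
  \<comment> \<open>The saturated \<open>R\<close>-submodule generated by \<open>m\<close>. Downward
    closure turns \<open>x * m \<preceq> \<phi> r * m\<close> into stability under
    \<open>x\<close>.\<close>
  define M where "M = {y. \<exists>r. y \<preceq> \<phi> r * m}"
  have zero: "0 \<in> M" unfolding M_def by simp
  have m_in: "m \<in> M" unfolding M_def using hom'(2) by (auto intro: exI[of _ 1])
  have add: "y + z \<in> M" if "y \<in> M" "z \<in> M" for y z
  proof -
    obtain s t where "y \<preceq> \<phi> s * m" "z \<preceq> \<phi> t * m"
      using \<open>y \<in> M\<close> \<open>z \<in> M\<close> unfolding M_def by blast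
    then have "y + z \<preceq> \<phi> (s + t) * m"
      by (simp only: hom'(3) distrib_right canon.sup_mono)
    then show ?thesis unfolding M_def by blast
  qed
  have down: "z \<in> M" if "z \<preceq> y" "y \<in> M" for y z
    using that canon.order_trans unfolding M_def by blast
  have scalar: "\<phi> s * y \<in> M" if y: "y \<in> M" for s y
  proof -
    obtain t where "y \<preceq> \<phi> t * m" using y unfolding M_def by blast
    then have "\<phi> s * y \<preceq> \<phi> (s * t) * m"
      by (simp add: canon_mult_left_mono hom'(4) mult.assoc)
    then show ?thesis unfolding M_def by blast
  qed
  have x: "x * y \<in> M" if y: "y \<in> M" for y
  proof -
    obtain t where "y \<preceq> \<phi> t * m" using y unfolding M_def by blast
    then have "x * y \<preceq> \<phi> t * (x * m)"
      by (metis canon_mult_left_mono mult.left_commute)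
    also have "\<dots> \<preceq> \<phi> t * (\<phi> r * m)"
      using r by (rule canon_mult_left_mono)
    finally show ?thesis
      using down scalar m_in by blast
  qed
  \<comment> \<open>By minimality of \<open>sat_adjoin \<phi> x\<close>, it suffices that the
    multipliers of \<open>M\<close> form a saturated subsemiring containing \<open>x\<close> and the
    image of \<open>R\<close>.\<close>
  define S where "S = {s. \<forall>y\<in>M. s * y \<in> M}"
  have "subsemiring S"
    unfolding subsemiring_def S_def using zero add by (auto simp: distrib_right mult.assoc)
  moreover have "saturated S"
    unfolding saturated_def S_def using down canon_mult_mono[OF _ canon.order_refl] by blast
  moreover have "x \<in> S" "range \<phi> \<subseteq> S"
    unfolding S_def using x scalar by auto
  ultimately have "sat_adjoin \<phi> x \<subseteq> S"
    by (rule sat_adjoin_smallest(5))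
  then have "submodule_of (sat_adjoin \<phi> x) (*) M"
    unfolding submodule_of_def using zero add by (auto simp: S_def)
  moreover have "finite_module UNIV (\<lambda>r m. \<phi> r * m) M"
    unfolding finite_module_def using m_in by (auto simp: M_def)
  moreover have "faithful_module (sat_adjoin \<phi> x) (*) M"
    unfolding faithful_module_def using unitgenerated_no_zero_divisors m m_in by blast
  ultimately show ?thesis
    unfolding quasiintegral_def by blast
qed

lemma valuation_contains_bounded_on:
  fixes V :: "'k::unitgenerated_semiring set"
  assumes V: "valuation_subsemiring V" and "bounded_on V x"
  shows "x \<in> V"
proof -
  obtain m a where m: "m \<noteq> 0" and a: "a \<in> V" "x * m \<preceq> a * m"
    using assms(2) unfolding bounded_on_def by blast
  obtain v where v: "1 \<preceq> v * m" "v * m \<in> V"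
    using valuation_normalize[OF V m] by blast
  have "x \<preceq> x * (v * m)"
    using v(1) by (rule canon_le_mult)
  also have "\<dots> \<preceq> a * (v * m)"
    using a(2) by (metis canon_mult_left_mono mult.left_commute)
  finally show ?thesis
    using V a(1) v(2) unfolding valuation_subsemiring_def saturated_def subsemiring_def by blast
qed

section \<open>Adjoining a unit or its inverse\<close>

text \<open>
  The powers of \<open>1 + w\<close> are cofinal among the polynomials in \<open>w\<close>, so this is the saturated
  subsemiring generated by \<open>V\<close> and \<open>w\<close>.
\<close>

definition adjoin :: "'a::idem_comm_semiring set \<Rightarrow> 'a \<Rightarrow> 'a set"
  where "adjoin V w = {y. \<exists>a\<in>V. \<exists>n. y \<preceq> a * (1 + w) ^ n}"

text \<open>Brings two bounds to the same coefficient and exponent. The bases may differ: closure of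
  \<open>adjoin V w\<close> under sums takes \<open>e = f\<close>, the comparison of
  \<open>w\<close> with its inverse does not.\<close>

lemma adjoin_common:
  assumes "1 \<preceq> e" "1 \<preceq> f" "y \<preceq> a * e ^ k" "z \<preceq> b * f ^ l"
  shows "y \<preceq> (a + b) * e ^ (k + l)" "z \<preceq> (a + b) * f ^ (k + l)"
  using assms by (meson canon.order_trans canon.sup_ge1 canon.sup_ge2 canon_mult_mono
      canon_power_mono le_add1 le_add2)+

lemma adjoin_properties:
  assumes "subsemiring V"
  shows "subsemiring (adjoin V w)" "saturated (adjoin V w)" "V \<subseteq> adjoin V w" "w \<in> adjoin V w"
proof -
  have V: "a + b \<in> V" "a * b \<in> V" if "a \<in> V" "b \<in> V" for a b
    using assms that unfolding subsemiring_def by auto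
  have one: "1 \<preceq> 1 + w" by simp
  have V01: "0 \<in> V" "1 \<in> V" using assms unfolding subsemiring_def by auto
  show sub: "V \<subseteq> adjoin V w"
    unfolding adjoin_def by (auto intro!: bexI exI[of _ 0])
  show "w \<in> adjoin V w"
    unfolding adjoin_def using V01 by (auto intro!: bexI[of _ 1] exI[of _ 1])
  show "saturated (adjoin V w)"
    unfolding adjoin_def saturated_def using canon.order_trans by blast
  have "y + z \<in> adjoin V w \<and> y * z \<in> adjoin V w" if "y \<in> adjoin V w" "z \<in> adjoin V w" for y z
  proof -
    obtain a k b l where ab: "a \<in> V" "b \<in> V" "y \<preceq> a * (1 + w) ^ k" "z \<preceq> b * (1 + w) ^ l"
      using \<open>y \<in> _\<close> \<open>z \<in> _\<close> unfolding adjoin_def by blast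
    have "y + z \<preceq> (a + b) * (1 + w) ^ (k + l)"
      using adjoin_common[OF one one ab(3,4)] by simp
    moreover have "y * z \<preceq> (a * b) * (1 + w) ^ (k + l)"
      using canon_mult_mono[OF ab(3,4)] by (simp add: power_add ac_simps)
    ultimately show ?thesis
      using V[OF ab(1,2)] unfolding adjoin_def by blast
  qed
  then show "subsemiring (adjoin V w)"
    unfolding subsemiring_def using sub V01 by blast
qed

lemma bounded_on_adjoin_unit:
  fixes V :: "'k::unitgenerated_semiring set"
  assumes V: "subsemiring V" and wv: "w * v = 1"
    and "bounded_on (adjoin V w) x" and "bounded_on (adjoin V v) x"
  shows "bounded_on V x"
proof -
  define e where "e = 1 + w"
  define f where "f = 1 + v"
  have e: "1 \<preceq> e" and f: "1 \<preceq> f" unfolding e_def f_def by auto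
  have ef: "e * f = e + f"
    using wv unfolding e_def f_def by (simp add: algebra_simps)
  obtain m1 a1 k where 1: "m1 \<noteq> 0" "a1 \<in> V" "x * m1 \<preceq> a1 * e ^ k * m1"
    using assms(3) canon_mult_mono[OF _ canon.order_refl] canon.order_trans
    unfolding bounded_on_def adjoin_def e_def by blast
  obtain m2 a2 l where 2: "m2 \<noteq> 0" "a2 \<in> V" "x * m2 \<preceq> a2 * f ^ l * m2"
    using assms(4) canon_mult_mono[OF _ canon.order_refl] canon.order_trans
    unfolding bounded_on_def adjoin_def f_def by blast
  define n where "n = k + l"
  define a where "a = a1 + a2"
  define m where "m = m1 * m2"
  define p where "p = e ^ n"
  define q where "q = f ^ n"
  have a1: "a1 * e ^ k \<preceq> a * p" and a2: "a2 * f ^ l \<preceq> a * q"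
    using adjoin_common[OF e f canon.order_refl canon.order_refl]
    unfolding n_def a_def p_def q_def by auto
  have "x * m1 * m2 \<preceq> (a * p * m1) * m2"
    using 1(3) a1 canon_mult_mono canon.order_trans canon.order_refl by meson
  then have x1: "x * m \<preceq> a * p * m" unfolding m_def by (simp add: mult.assoc)
  have "x * m2 * m1 \<preceq> (a * q * m2) * m1"
    using 2(3) a2 canon_mult_mono canon.order_trans canon.order_refl by meson
  then have x2: "x * m \<preceq> a * q * m" unfolding m_def by (simp add: ac_simps)
  have pq: "p * q = p + q"
    unfolding p_def q_def using e f ef by (rule power_mult_power_eq_add)
  \<comment> \<open>Each bound is multiplied by the other power, so that both right-hand sides
    become \<open>a * m * (p * q)\<close>; then \<open>p * q = p + q\<close> restores the factor on
    the left.\<close>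
  have "x * (m * (p + q)) = (x * m) * q + (x * m) * p"
    by (simp add: algebra_simps)
  also have "\<dots> \<preceq> (a * p * m) * q + (a * q * m) * p"
    using canon.sup_mono[OF canon_mult_mono[OF x1 canon.order_refl] canon_mult_mono[OF x2 canon.order_refl]] .
  also have "\<dots> = a * (m * (p * q))"
    by (simp add: ac_simps add_idem)
  finally have "x * (m * (p + q)) \<preceq> a * (m * (p + q))"
    by (simp add: pq)
  moreover have "m * (p + q) \<noteq> 0"
  proof -
    have "m \<preceq> m * (p + q)"
      unfolding p_def using canon_one_le_power[OF e] by (intro canon_le_mult canon.le_supI1)
    moreover have "m \<noteq> 0"
      unfolding m_def using unitgenerated_no_zero_divisors 1(1) 2(1) by blast
    ultimately show ?thesis by (metis canon.le_bot)
  qed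
  moreover have "a \<in> V"
    using V 1 2 unfolding a_def subsemiring_def by blast
  ultimately show ?thesis unfolding bounded_on_def by blast
qed

section \<open>Maximal subsemirings by Zorn's lemma\<close>

lemma exists_valuation_not_bounded_on:
  fixes x :: "'k::unitgenerated_semiring"
  assumes R: "subsemiring R" and x: "\<not> bounded_on R x"
  shows "\<exists>V. valuation_subsemiring V \<and> R \<subseteq> V \<and> \<not> bounded_on V x"
proof -
  define F where "F = {V. subsemiring V \<and> saturated V \<and> R \<subseteq> V \<and> \<not> bounded_on V x}"
  \<comment> \<open>Adjoining \<open>0\<close> merely saturates \<open>R\<close>.\<close>
  have "adjoin R 0 \<in> F"
  proof -
    have "\<not> bounded_on (adjoin R 0) x"
    proof
      assume "bounded_on (adjoin R 0) x"
      then show False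
        using x canon_mult_mono[OF _ canon.order_refl] canon.order_trans
        unfolding bounded_on_def adjoin_def by (simp; blast)
    qed
    then show ?thesis
      unfolding F_def using adjoin_properties[OF R] by blast
  qed
  moreover have "\<Union>C \<in> F" if "C \<noteq> {}" "subset.chain F C" for C
  proof -
    have C: "C \<subseteq> F" "\<And>A B. A \<in> C \<Longrightarrow> B \<in> C \<Longrightarrow> A \<subseteq> B \<or> B \<subseteq> A"
      using that(2) unfolding subset_chain_def by auto
    have "y + z \<in> \<Union>C \<and> y * z \<in> \<Union>C" if yz: "y \<in> \<Union>C" "z \<in> \<Union>C" for y z
    proof -
      obtain A where "A \<in> C" "y \<in> A" "z \<in> A"
        using yz C(2) by blast
      moreover from this have "subsemiring A" using C(1) unfolding F_def by blast
      ultimately show ?thesis unfolding subsemiring_def by blast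
    qed
    moreover obtain A where "A \<in> C" "subsemiring A"
      using C(1) \<open>C \<noteq> {}\<close> unfolding F_def by blast
    ultimately have "subsemiring (\<Union>C)"
      unfolding subsemiring_def by blast
    moreover have "saturated (\<Union>C)"
      using C(1) unfolding F_def saturated_def by blast
    moreover have "R \<subseteq> \<Union>C"
      using C(1) \<open>C \<noteq> {}\<close> unfolding F_def by blast
    \<comment> \<open>A bound involves a single coefficient \<open>a\<close>, which already lies in
      some member of the chain.\<close>
    moreover have "\<not> bounded_on (\<Union>C) x"
      using C(1) unfolding F_def bounded_on_def by blast
    ultimately show ?thesis unfolding F_def by blast
  qed
  ultimately obtain V where V: "V \<in> F" and max: "\<And>X. X \<in> F \<Longrightarrow> V \<subseteq> X \<Longrightarrow> X = V"
    using subset_Zorn_nonempty[of F] by blast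
  have sub: "subsemiring V" and R': "R \<subseteq> V" using V unfolding F_def by auto
  \<comment> \<open>\<open>adjoin V w\<close> properly extends \<open>V\<close> and meets all other
    conditions for \<open>F\<close>, so by maximality it must bound \<open>x\<close>.\<close>
  have adj: "bounded_on (adjoin V w) x" if "w \<notin> V" for w
    using max[of "adjoin V w"] adjoin_properties[OF sub, of w] that R' unfolding F_def by blast
  have "w \<in> V \<or> v \<in> V" if "w * v = 1" for w v
    using bounded_on_adjoin_unit[OF sub that] adj V unfolding F_def by blast
  then show ?thesis
    using V unfolding F_def valuation_subsemiring_def by blast
qed

theorem theorem6p8:
  fixes \<phi> :: "'r::idem_comm_semiring \<Rightarrow> 'k::unitgenerated_semiring"
  assumes "semiring_hom \<phi>"
  shows "quasiintegral_closure \<phi> = \<Inter>{V. valuation_subsemiring V \<and> range \<phi> \<subseteq> V}"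
proof (cases "(1::'k) = 0")
  \<comment> \<open>In the trivial semiring faithfulness is vacuous, so both sides are
    everything.\<close>
  case True
  then have triv: "y = 0" for y :: 'k
    by (metis mult_1 mult_zero_left)
  have "y \<preceq> z" for y z :: 'k
    using triv canon.order_refl by metis
  then have "quasiintegral \<phi> x" for x
    unfolding quasiintegral_def submodule_of_def finite_module_def faithful_module_def
    using triv by (intro exI[of _ UNIV]) blast
  moreover have "x \<in> V" if "valuation_subsemiring V" for x and V :: "'k set"
    using that triv[of x] unfolding valuation_subsemiring_def subsemiring_def by auto
  ultimately show ?thesis
    unfolding quasiintegral_closure_def by blast
next
  case False
  have hom: "\<phi> 0 = 0" "\<phi> 1 = 1" "\<phi> r + \<phi> s = \<phi> (r + s)" "\<phi> r * \<phi> s = \<phi> (r * s)" for r s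
    using assms by (auto simp: semiring_hom_def)
  have sub: "subsemiring (range \<phi>)"
    unfolding subsemiring_def using rangeI[of \<phi> 0] rangeI[of \<phi> 1] by (auto simp: hom)
  have "bounded_on (range \<phi>) x"
    if x: "\<And>V. valuation_subsemiring V \<Longrightarrow> range \<phi> \<subseteq> V \<Longrightarrow> x \<in> V" for x
  proof (rule ccontr)
    assume "\<not> bounded_on (range \<phi>) x"
    then obtain V where "valuation_subsemiring V" "range \<phi> \<subseteq> V" "\<not> bounded_on V x"
      using exists_valuation_not_bounded_on[OF sub] by blast
    \<comment> \<open>The witnesses are \<open>m = 1\<close>, nonzero in this case, and
      \<open>a = x\<close>.\<close>
    moreover have "bounded_on V x" if "x \<in> V" for V
      unfolding bounded_on_def using that False
      by - (rule exI[of _ 1], rule exI[of _ x], simp)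
    ultimately show False using x by blast
  qed
  moreover have "x \<in> V"
    if "bounded_on (range \<phi>) x" "valuation_subsemiring V" "range \<phi> \<subseteq> V" for x V
  proof -
    have "bounded_on V x"
      using that unfolding bounded_on_def by blast
    with that(2) show ?thesis by (rule valuation_contains_bounded_on)
  qed
  ultimately have "bounded_on (range \<phi>) x \<longleftrightarrow>
      (\<forall>V. valuation_subsemiring V \<and> range \<phi> \<subseteq> V \<longrightarrow> x \<in> V)" for x
    by metis
  moreover have "quasiintegral \<phi> x \<longleftrightarrow> bounded_on (range \<phi>) x" for x
    using quasiintegral_imp_bounded_on[OF _ False] bounded_on_imp_quasiintegral[OF assms] by metis
  ultimately show ?thesis
    unfolding quasiintegral_closure_def by (simp only: set_eq_iff mem_Collect_eq Inter_iff Ball_def) simp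
qed

end
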